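(* Let $n,m,l\in\mathbb{N}_{>0}$, $\mathcal{M}=\{A_1,\dots,A_m\}\subset\mathbb{R}^{n\times n}$, and $\gamma^*>0$. Let $P\succ 0$ be an optimal solution of the problem $\mathrm{Opt}(\omega_N)$ (for some sample $\omega_N$ and some $\eta>0$), and suppose that there is a Borel set $\tilde{\mathbb{S}}\subset\mathbb{S}$ with $\sigma^{n-1}(\tilde{\mathbb{S}})\le\tilde\varepsilon$ such that $$(\mathbf{A_j}x)^TP\,\mathbf{A_j}x\le(\gamma^* )^{2l}x^TPx\quad\text{for all }x\in\mathbb{S}\setminus\tilde{\mathbb{S}}\text{ and all }\mathbf{j}\in\{1,\dots,m\}^l.$$ Then $$\rho(\mathcal{M})\le\frac{\gamma^*}{\sqrt[l]{\delta\!\left(\frac{\tilde\varepsilon\,\kappa(P)}{2}\right)}},\qquad \kappa(P)=\sqrt{\frac{\det(P)}{\lambda_{\min}(P)^n}}.$$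
   Context: $\mathbb{S},\mathbb{B}$: Euclidean unit sphere and closed unit ball in $\mathbb{R}^n$. Uniform spherical measure: $\sigma^{n-1}(X)=\lambda(\{tx:x\in X,t\in[0,1]\})/\lambda(\mathbb{B})$, $\lambda$ Lebesgue measure. For $\mathbf{j}=(j_1,\dots,j_l)$, $\mathbf{A_j}=A_{j_l}\cdots A_{j_1}$. Joint spectral radius: $\rho(\mathcal{M})=\lim_{k\to\infty}\max\{\|A_{i_1}\cdots A_{i_k}\|^{1/k}:A_{i_j}\in\mathcal{M}\}$. A sample $\omega_N$ is a finite subset $\{(x_i,\mathbf{j}_i)\}_{i=1}^N$ of $\mathbb{S}\times\{1,\dots,m\}^l$; $\gamma^*(\omega_N)$ is the optimal value of $\min\gamma$ s.t. $(\mathbf{A_j}x)^TP\mathbf{A_j}x\le\gamma^{2l}x^TPx$ for all $(x,\mathbf{j})\in\omega_N$, $P\succ0$, $\gamma\ge0$. For $\eta>0$, $\mathrm{Opt}(\omega_N)$ is: minimize $\lambda_{\max}(P)$ over symmetric $P$ subject to $(\mathbf{A_j}x)^TP\mathbf{A_j}x\le((1+\eta)\gamma^*(\omega_N))^{2l}x^TPx$ for all $(x,\mathbf{j})\in\omega_N$ and $P\succeq I$. For $X\subset\mathbb{S}$, $\Delta(X)=\sup\{r\in[0,1]: r\mathbb{B}\subset\mathrm{conv}(\mathbb{S}\setminus X)\}$ (sup of empty set $=0$), and for $e\ge0$, $\delta(e)=\inf\{\Delta(X): X\subset\mathbb{S}\text{ Borel}, \sigma^{n-1}(X)\le e\}$;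 for $e\le 1/2$ this equals $\sqrt{1-I^{-1}(2e;\frac{n-1}{2},\frac12)}$ with $I$ the regularized incomplete beta function. Convention: $\gamma^*/0=+\infty$. *)

theory Defs
  imports "HOL-Analysis.Analysis"
begin

text \<open>Words j = (j_1,...,j_l) over the alphabet {1..m}.\<close>
definition words :: "nat \<Rightarrow> nat \<Rightarrow> nat list set" where
  "words m l = {js. length js = l \<and> set js \<subseteq> {1..m}}"

text \<open>A_j = A_{j_l} ... A_{j_1}\<close>
definition word_prod :: "(nat \<Rightarrow> real^'n^'n) \<Rightarrow> nat list \<Rightarrow> real^'n^'n" where
  "word_prod A js = foldl (\<lambda>M i. A i ** M) (mat 1) js"

text \<open>Joint spectral radius of {A_1,...,A_m} (induced Euclidean operator norm).\<close>
definition jsr :: "(nat \<Rightarrow> real^'n^'n) \<Rightarrow> nat \<Rightarrow> real" where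
  "jsr A m = lim (\<lambda>k. Max ((\<lambda>js. root k (onorm (\<lambda>x. word_prod A js *v x))) ` words m k))"

definition quadf :: "real^'n^'n \<Rightarrow> real^'n \<Rightarrow> real" where
  "quadf P x = x \<bullet> (P *v x)"

definition posdef :: "real^'n^'n \<Rightarrow> bool" where
  "posdef P \<longleftrightarrow> transpose P = P \<and> (\<forall>x. x \<noteq> 0 \<longrightarrow> quadf P x > 0)"

definition eigenvalues :: "real^'n^'n \<Rightarrow> real set" where
  "eigenvalues P = {\<mu>. \<exists>v. v \<noteq> 0 \<and> P *v v = \<mu> *\<^sub>R v}"

definition lambda_max :: "real^'n^'n \<Rightarrow> real" where
  "lambda_max P = Max (eigenvalues P)"

definition lambda_min :: "real^'n^'n \<Rightarrow> real" where
  "lambda_min P = Min (eigenvalues P)"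

definition kappa :: "real^'n^'n \<Rightarrow> real" where
  "kappa P = sqrt (det P / lambda_min P ^ CARD('n))"

text \<open>gamma^*(omega_N): optimal value of the sampled LMI problem.\<close>
definition gamma_star :: "(nat \<Rightarrow> real^'n^'n) \<Rightarrow> nat \<Rightarrow> ((real^'n) \<times> nat list) set \<Rightarrow> real" where
  "gamma_star A l \<omega> = Inf {\<gamma>. \<gamma> \<ge> 0 \<and> (\<exists>P. posdef P \<and>
      (\<forall>(x,js)\<in>\<omega>. quadf P (word_prod A js *v x) \<le> \<gamma> ^ (2*l) * quadf P x))}"

definition opt_feasible :: "(nat \<Rightarrow> real^'n^'n) \<Rightarrow> nat \<Rightarrow> real \<Rightarrow> ((real^'n) \<times> nat list) set \<Rightarrow> real^'n^'n \<Rightarrow> bool" where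
  "opt_feasible A l \<eta> \<omega> P \<longleftrightarrow> transpose P = P \<and> (\<forall>x. x \<bullet> x \<le> quadf P x) \<and>
     (\<forall>(x,js)\<in>\<omega>. quadf P (word_prod A js *v x) \<le> ((1 + \<eta>) * gamma_star A l \<omega>) ^ (2*l) * quadf P x)"

text \<open>P is an optimal solution of Opt(omega_N): minimise lambda_max over the feasible set.\<close>
definition opt_solution :: "(nat \<Rightarrow> real^'n^'n) \<Rightarrow> nat \<Rightarrow> real \<Rightarrow> ((real^'n) \<times> nat list) set \<Rightarrow> real^'n^'n \<Rightarrow> bool" where
  "opt_solution A l \<eta> \<omega> P \<longleftrightarrow> opt_feasible A l \<eta> \<omega> P \<and>
     (\<forall>Q. opt_feasible A l \<eta> \<omega> Q \<longrightarrow> lambda_max P \<le> lambda_max Q)"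

text \<open>Uniform spherical measure via the cone over X.\<close>
definition sph_measure :: "(real^'n) set \<Rightarrow> real" where
  "sph_measure X = measure lebesgue {t *\<^sub>R x | x t. x \<in> X \<and> t \<in> {0..1}} / measure lebesgue (cball (0::real^'n) 1)"

definition Delta :: "(real^'n) set \<Rightarrow> real" where
  "Delta X = (let R = {r \<in> {0..1}. cball (0::real^'n) r \<subseteq> convex hull (sphere 0 1 - X)}
              in if R = {} then 0 else Sup R)"

definition delta_fun :: "real \<Rightarrow> 'n::finite itself \<Rightarrow> real" where
  "delta_fun e _ = Inf {Delta X | X :: (real^'n) set. X \<in> sets borel \<and> X \<subseteq> sphere 0 1 \<and> sph_measure X \<le> e}"

end

(*
  In the norm x |-> |T x| with T = P^(1/2), the hypothesis says that every product A_j of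
  length l contracts by gamma^l on all directions outside the cone over the exceptional set St.
  Work in the coordinates z = T x.  The closed convex hull K of the good unit directions contains
  the ball of radius delta = delta(epsilon kappa(P) / 2): otherwise a hyperplane separates a point
  of that ball from K and cuts off a spherical cap of bad directions only.  The rescaled inverse
  sqrt(lambda_min P) T^(-1) is non-expanding with determinant 1 / kappa(P), and it maps the cones
  over the cap and over its antipodal copy into the cone over St; hence the cap has spherical
  measure at most epsilon kappa(P) / 2, while its Delta is below delta, contradicting the definition
  of delta.  The set where |T A_j T^(-1) z| <= gamma^l is closed and convex, so it contains K and
  the ball, i.e. |T A_j x| <= (gamma^l / delta) |T x| for all x and j.  Products of length q l are
  then bounded by a constant times (gamma^l / delta)^q, and Fekete's lemma turns this into the
  bound on the joint spectral radius.
*)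

theory Submission
  imports Defs
begin

section \<open>Lebesgue measure of linear images\<close>

lemma measure_preserving_linear_from_boxes:
  fixes f :: "real^'n \<Rightarrow> real^'n"
  assumes "linear f" and "\<bar>det (matrix f)\<bar> = 1"
    and "\<And>a b. measure lebesgue (f ` cbox a b) = measure lebesgue (cbox a b)"
  shows "\<forall>S \<in> lmeasurable. f ` S \<in> lmeasurable \<and>
           measure lebesgue (f ` S) = \<bar>det (matrix f)\<bar> * measure lebesgue S"
proof
  fix S :: "(real^'n) set"
  assume "S \<in> lmeasurable"
  moreover have "measure lebesgue (f ` cbox a b) = 1 * measure lebesgue (cbox a b)" for a b
    using assms(3) by simp
  ultimately have "f ` S \<in> lmeasurable \<and> 1 * measure lebesgue S = measure lebesgue (f ` S)"
    by (rule measure_linear_sufficient[OF assms(1)])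
  then show "f ` S \<in> lmeasurable \<and> measure lebesgue (f ` S) = \<bar>det (matrix f)\<bar> * measure lebesgue S"
    using assms(2) by simp
qed

lemma
  fixes f :: "real^'n \<Rightarrow> real^'n"
  assumes "linear f" and "\<And>x. f x $ i = 0"
  shows negligible_image_zero_coordinate: "negligible (f ` S)"
    and det_matrix_zero_coordinate: "det (matrix f) = 0"
proof -
  have "\<not> surj f"
    using assms(2) by (metis one_neq_zero surjE vec_component)
  then have "\<not> inj f"
    using assms(1) linear_injective_imp_surjective by blast
  then show "negligible (f ` S)"
    using assms(1) negligible_linear_singular_image by blast
  show "det (matrix f) = 0"
    by (rule det_zero_row[of i]) (simp add: row_def matrix_def assms(2) vec_eq_iff)
qed

lemma
  fixes a b :: "real^'n" and m n :: 'n
  defines "f \<equiv> \<lambda>x::real^'n. \<chi> i. x $ Transposition.transpose m n i"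
  assumes "m \<noteq> n"
  shows abs_det_matrix_coordinate_swap: "\<bar>det (matrix f)\<bar> = 1"
    and measure_coordinate_swap_cbox: "measure lebesgue (f ` cbox a b) = measure lebesgue (cbox a b)"
proof -
  have "matrix f = (\<chi> i j. mat 1 $ i $ Transposition.transpose m n j)"
    unfolding f_def matrix_def mat_def axis_def vec_eq_iff
    by (simp add: eq_commute[of _ "Transposition.transpose m n _"] transpose_eq_iff)
  then show "\<bar>det (matrix f)\<bar> = 1"
    by (simp add: det_permute_columns permutes_swap_id sign_swap_id \<open>m \<noteq> n\<close>)
  have box: "f ` cbox a b = cbox (f a) (f b)"
  proof
    show "f ` cbox a b \<subseteq> cbox (f a) (f b)"
      by (auto simp: f_def mem_box_cart)
    show "cbox (f a) (f b) \<subseteq> f ` cbox a b"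
    proof
      fix y assume "y \<in> cbox (f a) (f b)"
      then have "f y \<in> cbox a b"
        by (simp add: f_def mem_box_cart) (metis transpose_involutory)
      moreover have "y = f (f y)"
        by (simp add: f_def vec_eq_iff)
      ultimately show "y \<in> f ` cbox a b"
        by blast
    qed
  qed
  have "(\<Prod>i\<in>UNIV. (f b - f a) $ i) = (\<Prod>i\<in>UNIV. (b - a) $ i)"
    unfolding f_def using prod.permute[OF permutes_swap_id, of m UNIV n "\<lambda>i. (b - a) $ i"]
    by (simp add: comp_def)
  moreover have "cbox (f a) (f b) = {} \<longleftrightarrow> cbox a b = {}"
    using box by auto
  ultimately show "measure lebesgue (f ` cbox a b) = measure lebesgue (cbox a b)"
    unfolding box by (simp add: content_cbox_if_cart)
qed

lemma
  fixes a b :: "real^'n" and m n :: 'n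
  defines "f \<equiv> \<lambda>x::real^'n. \<chi> i. if i = m then x $ m + x $ n else x $ i"
  assumes "m \<noteq> n"
  shows det_matrix_shear: "det (matrix f) = 1"
    and measure_shear_cbox: "measure lebesgue (f ` cbox a b) = measure lebesgue (cbox a b)"
proof -
  have "matrix f = (\<chi> k. if k = m then row m (mat 1) + 1 *s row n (mat 1) else row k (mat 1))"
    unfolding f_def matrix_def row_def mat_def axis_def vec_eq_iff by simp
  then show "det (matrix f) = 1"
    using det_row_operation[OF \<open>m \<noteq> n\<close>, of "mat 1" 1] by simp
  show "measure lebesgue (f ` cbox a b) = measure lebesgue (cbox a b)"
  proof (cases "cbox a b = {}")
    case False
    define v :: "real^'n" where "v = axis n (a $ n)"
    have box: "cbox a b = (+) v ` cbox (a - v) (b - v)"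
      by (metis add.commute cbox_translation diff_add_cancel)
    have "linear f"
      unfolding f_def by (rule linearI) (simp_all add: vec_eq_iff algebra_simps)
    then have "f ` cbox a b = (+) (f v) ` (f ` cbox (a - v) (b - v))"
      unfolding box image_image using linear_add by metis
    then have "measure lebesgue (f ` cbox a b) = measure lebesgue (f ` cbox (a - v) (b - v))"
      by (simp add: measure_translation)
    also have "\<dots> = measure lebesgue (cbox (a - v) (b - v))"
      unfolding f_def using False \<open>m \<noteq> n\<close> by (intro measure_shear_interval) (auto simp: box v_def)
    also have "\<dots> = measure lebesgue (cbox a b)"
      by (simp add: box measure_translation)
    finally show ?thesis .
  qed simp
qed

text \<open>\<open>Change_Of_Vars.measure_linear_image\<close> assumes a well-ordered index type, which it uses only
  for the determinant of a shear; the same elementary-matrix induction works for any finite index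
  type.\<close>

proposition
  fixes f :: "real^'n \<Rightarrow> real^'n"
  assumes "linear f" "S \<in> lmeasurable"
  shows lmeasurable_linear_image_cart: "f ` S \<in> lmeasurable"
    and measure_linear_image_cart:
      "measure lebesgue (f ` S) = \<bar>det (matrix f)\<bar> * measure lebesgue S"
proof -
  let ?Q = "\<lambda>f. \<forall>S \<in> lmeasurable. f ` S \<in> lmeasurable \<and>
                  measure lebesgue (f ` S) = \<bar>det (matrix f)\<bar> * measure lebesgue S"
  have "?Q f"
  proof (rule induct_linear_elementary[OF \<open>linear f\<close>])
    fix f g :: "real^'n \<Rightarrow> real^'n"
    assume "linear f" "linear g" and f: "?Q f" and g: "?Q g"
    show "?Q (f \<circ> g)"
    proof
      fix S :: "(real^'n) set"
      assume "S \<in> lmeasurable"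
      with f g show "(f \<circ> g) ` S \<in> lmeasurable \<and>
          measure lebesgue ((f \<circ> g) ` S) = \<bar>det (matrix (f \<circ> g))\<bar> * measure lebesgue S"
        unfolding image_comp[symmetric] matrix_compose[OF \<open>linear g\<close> \<open>linear f\<close>]
        by (simp add: det_mul abs_mult)
    qed
  next
    fix f :: "real^'n \<Rightarrow> real^'n" and i
    assume f: "linear f" "\<And>x. f x $ i = 0"
    then show "?Q f"
      using negligible_image_zero_coordinate[OF f] det_matrix_zero_coordinate[OF f]
      by (simp add: negligible_iff_measure)
  next
    fix c :: "'n \<Rightarrow> real"
    show "?Q (\<lambda>x. \<chi> i. c i * x $ i)"
      by (simp add: measurable_stretch measure_stretch matrix_def axis_def det_diagonal)
  next
    fix m n :: 'n
    assume "m \<noteq> n"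
    have "linear (\<lambda>x::real^'n. \<chi> i. x $ Transposition.transpose m n i)"
      by (rule linearI) (simp_all add: vec_eq_iff)
    then show "?Q (\<lambda>x. \<chi> i. x $ Transposition.transpose m n i)"
      using \<open>m \<noteq> n\<close> abs_det_matrix_coordinate_swap measure_coordinate_swap_cbox
      by (intro measure_preserving_linear_from_boxes)
  next
    fix m n :: 'n
    assume "m \<noteq> n"
    have "linear (\<lambda>x::real^'n. \<chi> i. if i = m then x $ m + x $ n else x $ i)"
      by (rule linearI) (simp_all add: vec_eq_iff algebra_simps)
    then show "?Q (\<lambda>x. \<chi> i. if i = m then x $ m + x $ n else x $ i)"
      using det_matrix_shear[OF \<open>m \<noteq> n\<close>] measure_shear_cbox[OF \<open>m \<noteq> n\<close>]
      by (intro measure_preserving_linear_from_boxes) simp_all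
  qed
  with assms show "f ` S \<in> lmeasurable" "measure lebesgue (f ` S) = \<bar>det (matrix f)\<bar> * measure lebesgue S"
    by auto
qed

section \<open>Spectral decomposition of symmetric matrices\<close>

lemma symmetric_matrix_inner:
  fixes P :: "real^'n^'n"
  assumes "transpose P = P"
  shows "(P *v x) \<bullet> y = x \<bullet> (P *v y)"
  by (metis assms dot_lmul_matrix vector_transpose_matrix)

lemma linear_coeff_zero_if_quadratic_nonneg:
  fixes a b :: real
  assumes "\<And>t. 0 \<le> a * t + b * t\<^sup>2"
  shows "a = 0"
proof (rule ccontr)
  assume "a \<noteq> 0"
  define c where "c = \<bar>b\<bar> + 1"
  have "c > 0" "b < c"
    by (auto simp: c_def)
  have "a * (- a / c) + b * (- a / c)\<^sup>2 = a\<^sup>2 * (b - c) / c\<^sup>2"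
    using \<open>c > 0\<close> by (simp add: field_simps power2_eq_square)
  also have "\<dots> < 0"
    using \<open>a \<noteq> 0\<close> \<open>b < c\<close> \<open>c > 0\<close> by (intro divide_neg_pos mult_pos_neg) auto
  finally show False
    using assms[of "- a / c"] by linarith
qed

lemma symmetric_quadratic_form_shift:
  fixes P :: "real^'n^'n"
  assumes "transpose P = P"
  shows "(v + t *\<^sub>R u) \<bullet> (P *v (v + t *\<^sub>R u)) - \<mu> * ((v + t *\<^sub>R u) \<bullet> (v + t *\<^sub>R u))
    = (v \<bullet> (P *v v) - \<mu> * (v \<bullet> v)) + 2 * t * (u \<bullet> (P *v v - \<mu> *\<^sub>R v))
      + t\<^sup>2 * (u \<bullet> (P *v u) - \<mu> * (u \<bullet> u))"
  using symmetric_matrix_inner[OF assms(1), of u v]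
  by (simp add: matrix_vector_right_distrib matrix_vector_mult_scaleR inner_add_left
      inner_add_right inner_diff_right inner_commute power2_eq_square algebra_simps)

lemma rayleigh_quotient_minimizer:
  fixes P :: "real^'n^'n"
  assumes "subspace V" "V \<noteq> {0}"
  obtains v where "v \<in> V" "norm v = 1" "\<And>y. y \<in> V \<Longrightarrow> (v \<bullet> (P *v v)) * (y \<bullet> y) \<le> y \<bullet> (P *v y)"
proof -
  have sgn_in: "sgn y \<in> V \<inter> sphere 0 1" if "y \<in> V" "y \<noteq> 0" for y
    using that by (simp add: assms(1) sgn_div_norm norm_sgn subspace_scale)
  have "compact (V \<inter> sphere 0 1)"
    by (simp add: assms(1) closed_Int_compact closed_subspace)
  moreover have "V \<inter> sphere 0 1 \<noteq> {}"
    using assms sgn_in subspace_0 by blast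
  moreover have "continuous_on (V \<inter> sphere 0 1) (\<lambda>y. y \<bullet> (P *v y))"
    by (intro continuous_intros linear_continuous_on matrix_vector_mul_bounded_linear)
  ultimately obtain v where v: "v \<in> V \<inter> sphere 0 1"
    and v_min: "\<forall>y \<in> V \<inter> sphere 0 1. v \<bullet> (P *v v) \<le> y \<bullet> (P *v y)"
    using continuous_attains_inf by blast
  have "(v \<bullet> (P *v v)) * (y \<bullet> y) \<le> y \<bullet> (P *v y)" if "y \<in> V" for y
  proof (cases "y = 0")
    case False
    have "v \<bullet> (P *v v) \<le> sgn y \<bullet> (P *v sgn y)"
      using v_min sgn_in[OF that False] by blast
    also have "sgn y \<bullet> (P *v sgn y) = (y \<bullet> (P *v y)) / (norm y)\<^sup>2"
      by (simp add: sgn_div_norm matrix_vector_mult_scaleR power2_eq_square divide_inverse)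
    finally show ?thesis
      using False by (simp add: pos_le_divide_eq power2_norm_eq_inner)
  qed simp
  with v show thesis
    using that by auto
qed

lemma symmetric_eigenvector_in_invariant_subspace:
  fixes P :: "real^'n^'n"
  assumes sym: "transpose P = P" and V: "subspace V" "V \<noteq> {0}"
    and inv: "\<And>x. x \<in> V \<Longrightarrow> P *v x \<in> V"
  obtains v \<mu> where "v \<in> V" "norm v = 1" "P *v v = \<mu> *\<^sub>R v"
proof -
  obtain v where v: "v \<in> V" "norm v = 1"
    and v_min: "\<And>y. y \<in> V \<Longrightarrow> (v \<bullet> (P *v v)) * (y \<bullet> y) \<le> y \<bullet> (P *v y)"
    using rayleigh_quotient_minimizer[OF V] by blast
  define \<mu> where "\<mu> = v \<bullet> (P *v v)"
  define q where "q y = y \<bullet> (P *v y) - \<mu> * (y \<bullet> y)" for y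
  define u where "u = P *v v - \<mu> *\<^sub>R v"
  have "u \<in> V"
    unfolding u_def using v by (simp add: V(1) inv subspace_diff subspace_scale)
  have "q v = 0"
    using v by (simp add: q_def \<mu>_def dot_square_norm)
  \<comment> \<open>\<open>q\<close> is nonnegative on \<open>V\<close> and vanishes at \<open>v\<close>, so its derivative at \<open>v\<close> in direction \<open>u\<close> vanishes.\<close>
  have "0 \<le> 2 * (u \<bullet> u) * t + q u * t\<^sup>2" for t
  proof -
    have "v + t *\<^sub>R u \<in> V"
      using v \<open>u \<in> V\<close> by (simp add: V(1) subspace_add subspace_scale)
    then have "0 \<le> q (v + t *\<^sub>R u)"
      using v_min by (simp add: q_def \<mu>_def)
    also have "q (v + t *\<^sub>R u) = 2 * (u \<bullet> u) * t + q u * t\<^sup>2"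
      unfolding q_def symmetric_quadratic_form_shift[OF sym] using \<open>q v = 0\<close>
      by (simp add: q_def u_def)
    finally show ?thesis .
  qed
  then have "2 * (u \<bullet> u) = 0"
    by (rule linear_coeff_zero_if_quadratic_nonneg)
  then have "P *v v = \<mu> *\<^sub>R v"
    by (simp add: u_def)
  with v show thesis
    by (intro that[of v \<mu>]) auto
qed

locale orthonormal_eigenbasis =
  fixes P :: "real^'n^'n" and B :: "(real^'n) set" and \<mu> :: "real^'n \<Rightarrow> real"
  assumes finite_basis: "finite B" and orthogonal_basis: "pairwise orthogonal B"
    and norm_basis: "\<And>b. b \<in> B \<Longrightarrow> norm b = 1" and span_basis: "span B = UNIV"
    and eigenvector_basis: "\<And>b. b \<in> B \<Longrightarrow> P *v b = \<mu> b *\<^sub>R b"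
begin

lemma inner_sum_basis:
  assumes "c \<in> B"
  shows "(\<Sum>b\<in>B. f b *\<^sub>R b) \<bullet> c = f c"
proof -
  have "(\<Sum>b\<in>B. f b *\<^sub>R b) \<bullet> c = f c * (c \<bullet> c) + (\<Sum>b\<in>B - {c}. f b * (b \<bullet> c))"
    unfolding inner_sum_left using finite_basis assms by (simp add: sum.remove)
  also have "(\<Sum>b\<in>B - {c}. f b * (b \<bullet> c)) = 0"
    using orthogonal_basis assms by (intro sum.neutral) (auto simp: pairwise_def orthogonal_def)
  finally show ?thesis
    using norm_basis[OF assms] by (simp add: dot_square_norm)
qed

lemma expand: "(\<Sum>b\<in>B. (x \<bullet> b) *\<^sub>R b) = x"
  using orthonormal_basis_expand[OF orthogonal_basis norm_basis _ finite_basis] span_basis by simp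

lemma eq_iff_inner_basis: "x = y \<longleftrightarrow> (\<forall>b\<in>B. x \<bullet> b = y \<bullet> b)"
proof
  assume "\<forall>b\<in>B. x \<bullet> b = y \<bullet> b"
  then have "(\<Sum>b\<in>B. (x \<bullet> b) *\<^sub>R b) = (\<Sum>b\<in>B. (y \<bullet> b) *\<^sub>R b)"
    by (intro sum.cong) auto
  then show "x = y"
    by (simp only: expand)
qed simp

lemma inner_expand: "x \<bullet> y = (\<Sum>b\<in>B. (x \<bullet> b) * (y \<bullet> b))"
proof -
  have "x \<bullet> y = x \<bullet> (\<Sum>b\<in>B. (y \<bullet> b) *\<^sub>R b)"
    by (simp only: expand)
  also have "\<dots> = (\<Sum>b\<in>B. (x \<bullet> b) * (y \<bullet> b))"
    by (simp add: inner_sum_right mult.commute)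
  finally show ?thesis .
qed

lemma norm_expand: "(norm x)\<^sup>2 = (\<Sum>b\<in>B. (x \<bullet> b)\<^sup>2)"
  unfolding power2_norm_eq_inner inner_expand[of x x] by (simp add: power2_eq_square)

lemma mult_expand: "P *v x = (\<Sum>b\<in>B. (\<mu> b * (x \<bullet> b)) *\<^sub>R b)"
proof -
  have "P *v x = (\<Sum>b\<in>B. (x \<bullet> b) *\<^sub>R (P *v b))"
    by (subst expand[of x, symmetric]) (simp add: matrix_vector_mult_scaleR vec.sum)
  then show ?thesis
    by (simp add: eigenvector_basis mult.commute)
qed

lemma quadf_expand: "quadf P x = (\<Sum>b\<in>B. \<mu> b * (x \<bullet> b)\<^sup>2)"
  unfolding quadf_def mult_expand by (simp add: inner_sum_right power2_eq_square algebra_simps)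

lemma eigenvalues_eq: "eigenvalues P = \<mu> ` B"
proof
  show "\<mu> ` B \<subseteq> eigenvalues P"
  proof
    fix \<nu> assume "\<nu> \<in> \<mu> ` B"
    then obtain b where "b \<in> B" "\<nu> = \<mu> b"
      by blast
    moreover have "b \<noteq> 0"
      using norm_basis[OF \<open>b \<in> B\<close>] by auto
    ultimately show "\<nu> \<in> eigenvalues P"
      unfolding eigenvalues_def using eigenvector_basis by blast
  qed
  show "eigenvalues P \<subseteq> \<mu> ` B"
  proof
    fix \<nu> assume "\<nu> \<in> eigenvalues P"
    then obtain v where "v \<noteq> 0" "P *v v = \<nu> *\<^sub>R v"
      by (auto simp: eigenvalues_def)
    moreover obtain b where "b \<in> B" "v \<bullet> b \<noteq> 0"
      using \<open>v \<noteq> 0\<close> eq_iff_inner_basis[of v 0] by auto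
    moreover have "(P *v v) \<bullet> b = \<mu> b * (v \<bullet> b)"
      using \<open>b \<in> B\<close> by (simp add: mult_expand inner_sum_basis)
    ultimately show "\<nu> \<in> \<mu> ` B"
      by auto
  qed
qed

end

lemma symmetric_orthogonal_complement_invariant:
  fixes P :: "real^'n^'n"
  assumes "transpose P = P" and "\<forall>b\<in>B. \<exists>\<mu>. P *v b = \<mu> *\<^sub>R b"
    and "\<forall>b\<in>B. orthogonal b y"
  shows "\<forall>b\<in>B. orthogonal b (P *v y)"
proof
  fix b assume "b \<in> B"
  then obtain \<mu> where "P *v b = \<mu> *\<^sub>R b"
    using assms(2) by blast
  then show "orthogonal b (P *v y)"
    using assms(3) \<open>b \<in> B\<close> symmetric_matrix_inner[OF assms(1), of b y]
    by (simp add: orthogonal_def)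
qed

lemma symmetric_orthonormal_eigenvectors:
  fixes P :: "real^'n^'n"
  assumes sym: "transpose P = P" and "k \<le> DIM(real^'n)"
  shows "\<exists>B. finite B \<and> card B = k \<and> pairwise orthogonal B \<and>
           (\<forall>b\<in>B. norm b = 1 \<and> (\<exists>\<mu>. P *v b = \<mu> *\<^sub>R b))"
  using assms(2)
proof (induction k)
  case 0
  show ?case
    by (intro exI[of _ "{}"]) simp
next
  case (Suc k)
  then obtain B where B: "finite B" "card B = k" "pairwise orthogonal B"
    and B_eig: "\<forall>b\<in>B. norm b = 1 \<and> (\<exists>\<mu>. P *v b = \<mu> *\<^sub>R b)"
    by auto
  define V where "V = {y. \<forall>b\<in>B. orthogonal b y}"
  have "independent B"
    using B(3) B_eig pairwise_orthogonal_independent by fastforce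
  then have "dim B < DIM(real^'n)"
    using B(2) Suc.prems by (simp add: dim_eq_card_independent)
  then obtain x where "x \<noteq> 0" "\<And>y. y \<in> span B \<Longrightarrow> orthogonal x y"
    by (rule orthogonal_to_subspace_exists) auto
  then have "x \<in> V"
    by (simp add: V_def orthogonal_commute span_base)
  then have "V \<noteq> {0}"
    using \<open>x \<noteq> 0\<close> by blast
  have "\<forall>b\<in>B. \<exists>\<mu>. P *v b = \<mu> *\<^sub>R b"
    using B_eig by blast
  then have "P *v y \<in> V" if "y \<in> V" for y
    using symmetric_orthogonal_complement_invariant[OF sym] that by (simp add: V_def)
  with \<open>V \<noteq> {0}\<close> obtain v \<mu> where v: "v \<in> V" "norm v = 1" "P *v v = \<mu> *\<^sub>R v"
    using symmetric_eigenvector_in_invariant_subspace[OF sym subspace_orthogonal_to_vectors]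
    unfolding V_def by blast
  have "v \<notin> B"
    using v by (auto simp: V_def orthogonal_def dot_square_norm)
  show ?case
  proof (intro exI[of _ "insert v B"] conjI)
    show "pairwise orthogonal (insert v B)"
      using B(3) v(1) by (auto intro!: pairwise_orthogonal_insert simp: V_def orthogonal_commute)
  qed (use B B_eig v \<open>v \<notin> B\<close> in auto)
qed

lemma symmetric_orthonormal_eigenbasis:
  fixes P :: "real^'n^'n"
  assumes "transpose P = P"
  obtains B \<mu> where "orthonormal_eigenbasis P B \<mu>"
proof -
  obtain B where B: "finite B" "card B = DIM(real^'n)" "pairwise orthogonal B"
    and B_eig: "\<forall>b\<in>B. norm b = 1 \<and> (\<exists>\<mu>. P *v b = \<mu> *\<^sub>R b)"
    using symmetric_orthonormal_eigenvectors[OF assms order_refl] by blast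
  have "independent B"
    using B(3) B_eig pairwise_orthogonal_independent by fastforce
  then have "span B = UNIV"
    using B(2) by (simp add: dim_eq_card_independent dim_eq_full[symmetric])
  moreover obtain \<mu> where "\<And>b. b \<in> B \<Longrightarrow> P *v b = \<mu> b *\<^sub>R b"
    using B_eig by metis
  ultimately show thesis
    using that[of B \<mu>] B B_eig by (simp add: orthonormal_eigenbasis_def)
qed

lemma posdef_orthonormal_eigenbasis:
  fixes P :: "real^'n^'n"
  assumes "posdef P"
  obtains B \<mu> where "orthonormal_eigenbasis P B \<mu>" "\<And>b. b \<in> B \<Longrightarrow> \<mu> b > 0"
proof -
  obtain B \<mu> where B: "orthonormal_eigenbasis P B \<mu>"
    using symmetric_orthonormal_eigenbasis assms unfolding posdef_def by blast
  then interpret orthonormal_eigenbasis P B \<mu> .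
  have "\<mu> b > 0" if "b \<in> B" for b
  proof -
    have "quadf P b > 0"
      using assms norm_basis[OF that] unfolding posdef_def by (metis norm_zero zero_neq_one)
    then show ?thesis
      using that norm_basis[OF that] by (simp add: quadf_def eigenvector_basis dot_square_norm)
  qed
  with B show thesis
    using that by blast
qed

lemma posdef_lambda_min:
  fixes P :: "real^'n^'n"
  assumes "posdef P"
  shows "lambda_min P > 0" and "lambda_min P * (norm x)\<^sup>2 \<le> quadf P x"
proof -
  obtain B \<mu> where "orthonormal_eigenbasis P B \<mu>" and pos: "\<And>b. b \<in> B \<Longrightarrow> \<mu> b > 0"
    using posdef_orthonormal_eigenbasis[OF assms] by blast
  interpret orthonormal_eigenbasis P B \<mu> by fact
  have "B \<noteq> {}"
    using span_basis by auto
  then have lambda_min_eq: "lambda_min P = Min (\<mu> ` B)"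
    by (simp add: lambda_min_def eigenvalues_eq)
  show "lambda_min P > 0"
    using finite_basis \<open>B \<noteq> {}\<close> pos by (simp add: lambda_min_eq)
  have "lambda_min P * (norm x)\<^sup>2 = (\<Sum>b\<in>B. lambda_min P * (x \<bullet> b)\<^sup>2)"
    by (simp add: norm_expand sum_distrib_left)
  also have "\<dots> \<le> quadf P x"
    unfolding quadf_expand lambda_min_eq using finite_basis
    by (intro sum_mono mult_right_mono) auto
  finally show "lambda_min P * (norm x)\<^sup>2 \<le> quadf P x" .
qed

lemma posdef_square_root:
  fixes P :: "real^'n^'n"
  assumes "posdef P"
  obtains S where "S ** S = P" and "\<And>x. (norm (S *v x))\<^sup>2 = quadf P x"
proof -
  obtain B \<mu> where "orthonormal_eigenbasis P B \<mu>" and pos: "\<And>b. b \<in> B \<Longrightarrow> \<mu> b > 0"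
    using posdef_orthonormal_eigenbasis[OF assms] by blast
  interpret orthonormal_eigenbasis P B \<mu> by fact
  define T where "T x = (\<Sum>b\<in>B. (sqrt (\<mu> b) * (x \<bullet> b)) *\<^sub>R b)" for x
  have "linear T"
    by (rule linearI) (simp_all add: T_def inner_add_left algebra_simps sum.distrib scaleR_sum_right)
  have T_basis: "T x \<bullet> b = sqrt (\<mu> b) * (x \<bullet> b)" if "b \<in> B" for x b
    unfolding T_def using that by (rule inner_sum_basis)
  have "T (T x) \<bullet> c = (P *v x) \<bullet> c" if "c \<in> B" for x c
    using pos[OF that]
    by (simp add: T_basis[OF that] mult_expand inner_sum_basis[OF that] mult.assoc[symmetric])
  then have "T \<circ> T = (*v) P"
    by (auto simp: eq_iff_inner_basis)
  then have "matrix T ** matrix T = P"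
    using matrix_compose[OF \<open>linear T\<close> \<open>linear T\<close>] by (simp add: matrix_of_matrix_vector_mul)
  moreover have "(norm (matrix T *v x))\<^sup>2 = quadf P x" for x
  proof -
    have "(norm (T x))\<^sup>2 = (\<Sum>b\<in>B. (sqrt (\<mu> b) * (x \<bullet> b))\<^sup>2)"
      by (simp add: norm_expand T_basis)
    also have "\<dots> = quadf P x"
      unfolding quadf_expand power_mult_distrib by (intro sum.cong refl) (simp add: less_imp_le[OF pos])
    finally show ?thesis
      using fun_cong[OF matrix_vector_mul(2)[OF \<open>linear T\<close>]] by simp
  qed
  ultimately show thesis
    using that by blast
qed

lemma kappa_eq_of_square_root:
  fixes P S :: "real^'n^'n"
  assumes "S ** S = P"
  shows "kappa P = \<bar>det S\<bar> / sqrt (lambda_min P) ^ CARD('n)"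
  unfolding kappa_def
  by (simp add: assms[symmetric] det_mul real_sqrt_divide real_sqrt_power real_sqrt_mult)

lemma posdef_normalizing_maps:
  fixes P :: "real^'n^'n"
  assumes "posdef P"
  obtains T L :: "real^'n \<Rightarrow> real^'n" and s :: real
  where "linear T" "inj T" "linear L" "s > 0" "\<And>x. (norm (T x))\<^sup>2 = quadf P x"
    "\<And>x. L (T x) = s *\<^sub>R x" "\<And>z. T (L z) = s *\<^sub>R z" "\<And>z. norm (L z) \<le> norm z"
    "det (matrix L) \<noteq> 0" "kappa P = 1 / \<bar>det (matrix L)\<bar>"
proof -
  obtain S where S: "S ** S = P" "\<And>x. (norm (S *v x))\<^sup>2 = quadf P x"
    using posdef_square_root[OF assms] by blast
  define s where "s = sqrt (lambda_min P)"
  have "s > 0"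
    using posdef_lambda_min(1)[OF assms] by (simp add: s_def)
  have S_lower: "s * norm x \<le> norm (S *v x)" for x
  proof (rule power2_le_imp_le)
    show "(s * norm x)\<^sup>2 \<le> (norm (S *v x))\<^sup>2"
      using posdef_lambda_min(1)[OF assms] posdef_lambda_min(2)[OF assms, of x]
      by (simp add: s_def S(2) power_mult_distrib)
  qed simp
  have "x = 0" if "S *v x = 0" for x
    using S_lower[of x] \<open>s > 0\<close> that by (simp add: mult_le_0_iff)
  then have "inj ((*v) S)"
    by (intro linear_inj_on_iff_eq_0[THEN iffD2, OF matrix_vector_mul_linear]) auto
  then obtain Si where Si: "Si ** S = mat 1" "S ** Si = mat 1"
    using matrix_left_invertible_injective matrix_left_right_inverse by metis
  define L where "L z = s *\<^sub>R (Si *v z)" for z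
  have L_comp: "L = (*\<^sub>R) s \<circ> (*v) Si"
    by (auto simp: L_def)
  have "linear L"
    unfolding L_comp by (intro linear_compose matrix_vector_mul_linear linear_scaleR)
  moreover have "L (S *v x) = s *\<^sub>R x" "S *v L x = s *\<^sub>R x" for x
    using Si by (simp_all add: L_def matrix_vector_mul_assoc matrix_vector_mult_scaleR)
  moreover have "norm (L z) \<le> norm z" for z
    using S_lower[of "Si *v z"] Si(2) \<open>s > 0\<close> by (simp add: L_def matrix_vector_mul_assoc)
  moreover have det_L: "det (matrix L) = s ^ CARD('n) * det Si"
    unfolding L_comp by (simp add: matrix_compose[OF matrix_vector_mul_linear linear_scaleR] det_mul)
  moreover have "det Si * det S = 1"
    using Si(1) by (metis det_I det_mul)
  then have "det Si \<noteq> 0" "\<bar>det S\<bar> = 1 / \<bar>det Si\<bar>"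
    by (auto simp: abs_mult[symmetric] eq_divide_eq mult.commute)
  then have "det (matrix L) \<noteq> 0" "kappa P = 1 / \<bar>det (matrix L)\<bar>"
    using \<open>s > 0\<close> by (simp_all add: det_L kappa_eq_of_square_root[OF S(1)] abs_mult flip: s_def)
  ultimately show thesis
    using that[of "(*v) S" L s] S(2) \<open>inj ((*v) S)\<close> \<open>s > 0\<close> by (simp add: matrix_vector_mul_linear)
qed

section \<open>Joint spectral radius\<close>

lemma foldl_word_prod:
  fixes A :: "nat \<Rightarrow> real^'n^'n" and M0 :: "real^'n^'n"
  shows "foldl (\<lambda>M i. A i ** M) M0 js = foldl (\<lambda>M i. A i ** M) (mat 1) js ** M0"
proof (induction js arbitrary: M0)
  case (Cons j js)
  show ?case
    using Cons.IH[of "A j ** M0"] Cons.IH[of "A j ** mat 1"] by (simp add: matrix_mul_assoc matrix_mul_rid)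
qed (simp add: matrix_mul_lid)

lemma word_prod_append: "word_prod A (js @ ks) = word_prod A ks ** word_prod A js"
  unfolding word_prod_def by (simp add: foldl_word_prod[of A "foldl _ (mat 1) js"])

lemma words_append_split:
  "js \<in> words m (a + b) \<Longrightarrow> take a js \<in> words m a \<and> drop a js \<in> words m b"
  unfolding words_def using set_take_subset[of a js] set_drop_subset[of a js] by auto

lemma finite_words: "finite (words m k)"
  unfolding words_def using finite_lists_length_eq[of "{1..m}" k] by (simp add: conj_commute)

lemma words_nonempty: "m > 0 \<Longrightarrow> words m k \<noteq> {}"
proof -
  assume "m > 0"
  then have "replicate k 1 \<in> words m k"
    by (auto simp: words_def)
  then show ?thesis
    by blast
qed

definition max_word_norm :: "(nat \<Rightarrow> real^'n^'n) \<Rightarrow> nat \<Rightarrow> nat \<Rightarrow> real" where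
  "max_word_norm A m k = Max ((\<lambda>js. onorm ((*v) (word_prod A js))) ` words m k)"

context
  fixes A :: "nat \<Rightarrow> real^'n^'n" and m :: nat
  assumes m: "m > 0"
begin

lemma max_word_norm_ge: "js \<in> words m k \<Longrightarrow> onorm ((*v) (word_prod A js)) \<le> max_word_norm A m k"
  unfolding max_word_norm_def using finite_words by (intro Max_ge) auto

lemma max_word_norm_le:
  "(\<And>js. js \<in> words m k \<Longrightarrow> onorm ((*v) (word_prod A js)) \<le> c) \<Longrightarrow> max_word_norm A m k \<le> c"
  unfolding max_word_norm_def using finite_words words_nonempty[OF m] by (subst Max_le_iff) auto

lemma max_word_norm_nonneg: "max_word_norm A m k \<ge> 0"
proof -
  obtain js where "js \<in> words m k"
    using words_nonempty[OF m] by blast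
  then show ?thesis
    using max_word_norm_ge onorm_pos_le[OF matrix_vector_mul_bounded_linear] order_trans by blast
qed

lemma max_word_norm_submult: "max_word_norm A m (a + b) \<le> max_word_norm A m a * max_word_norm A m b"
proof (rule max_word_norm_le)
  fix js assume "js \<in> words m (a + b)"
  then have w: "take a js \<in> words m a" "drop a js \<in> words m b"
    using words_append_split by blast+
  have "onorm ((*v) (word_prod A js)) = onorm ((*v) (word_prod A (drop a js)) \<circ> (*v) (word_prod A (take a js)))"
    using word_prod_append[of A "take a js" "drop a js"] by (simp add: comp_def matrix_vector_mul_assoc)
  also have "\<dots> \<le> onorm ((*v) (word_prod A (drop a js))) * onorm ((*v) (word_prod A (take a js)))"
    by (intro onorm_compose matrix_vector_mul_bounded_linear)
  also have "\<dots> \<le> max_word_norm A m b * max_word_norm A m a"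
    using max_word_norm_ge[OF w(2)] max_word_norm_ge[OF w(1)] max_word_norm_nonneg
      onorm_pos_le[OF matrix_vector_mul_bounded_linear] by (intro mult_mono) auto
  finally show "onorm ((*v) (word_prod A js)) \<le> max_word_norm A m a * max_word_norm A m b"
    by (simp add: mult.commute)
qed

end

lemma submultiplicative_iterate:
  fixes f :: "nat \<Rightarrow> real"
  assumes nonneg: "\<And>k. f k \<ge> 0" and submult: "\<And>a b. f (a + b) \<le> f a * f b"
  shows "f (q * k + r) \<le> f k ^ q * f r"
proof (induction q)
  case (Suc q)
  have "f (Suc q * k + r) \<le> f k * f (q * k + r)"
    using submult[of k "q * k + r"] by (simp add: add.assoc)
  also have "\<dots> \<le> f k * (f k ^ q * f r)"
    using Suc.IH nonneg by (intro mult_left_mono) auto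
  finally show ?case
    by simp
qed simp

lemma submultiplicative_le_geometric:
  fixes f :: "nat \<Rightarrow> real"
  assumes nonneg: "\<And>k. f k \<ge> 0" and submult: "\<And>a b. f (a + b) \<le> f a * f b"
    and "k \<ge> 1" "t > 0" "f k \<le> t ^ k"
  obtains D where "D > 0" "\<And>n. f n \<le> t ^ n * D"
proof -
  define C where "C = (\<Sum>r<k. f r) + 1"
  have C: "C > 0" "\<And>r. r < k \<Longrightarrow> f r \<le> C"
    using nonneg by (auto simp: C_def add_nonneg_pos sum_nonneg
        intro!: member_le_sum order.trans[OF _ less_imp_le[OF less_add_one]])
  define d where "d = (min 1 t) ^ k"
  have d: "d > 0" "\<And>r. r < k \<Longrightarrow> d \<le> t ^ r"
  proof -
    show "d > 0"
      using \<open>t > 0\<close> by (simp add: d_def)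
    fix r assume "r < k"
    have "(min 1 t) ^ k \<le> (min 1 t) ^ r"
      using \<open>r < k\<close> \<open>t > 0\<close> by (intro power_decreasing) auto
    also have "\<dots> \<le> t ^ r"
      using \<open>t > 0\<close> by (intro power_mono) auto
    finally show "d \<le> t ^ r"
      unfolding d_def .
  qed
  have "f n \<le> t ^ n * (C / d)" for n
  proof -
    define q r where "q = n div k" and "r = n mod k"
    have n: "n = q * k + r" and "r < k"
      using \<open>k \<ge> 1\<close> by (simp_all add: q_def r_def)
    have "f n \<le> f k ^ q * f r"
      unfolding n by (rule submultiplicative_iterate[OF nonneg submult])
    also have "\<dots> \<le> (t ^ k) ^ q * C"
      using assms(5) C \<open>r < k\<close> nonneg \<open>t > 0\<close> by (intro mult_mono power_mono) auto
    also have "\<dots> = t ^ n / t ^ r * C"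
      using \<open>t > 0\<close> by (simp add: n power_add power_mult mult.commute)
    also have "\<dots> \<le> t ^ n / d * C"
      using d \<open>r < k\<close> \<open>t > 0\<close> C by (intro mult_right_mono divide_left_mono) auto
    finally show ?thesis
      by simp
  qed
  with C d show thesis
    using that[of "C / d"] by simp
qed

text \<open>Fekete's lemma, multiplicative form.\<close>

lemma submultiplicative_root_tendsto_Inf:
  fixes f :: "nat \<Rightarrow> real"
  assumes nonneg: "\<And>k. f k \<ge> 0" and submult: "\<And>a b. f (a + b) \<le> f a * f b"
  shows "(\<lambda>k. root k (f k)) \<longlonglongrightarrow> (INF k\<in>{1..}. root k (f k))"
proof (rule order_tendstoI)
  have root_nonneg: "root k (f k) \<ge> 0" for k
    using nonneg[of k] by (cases k) auto
  have bdd: "bdd_below ((\<lambda>k. root k (f k)) ` {1..})"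
    using root_nonneg by (intro bdd_belowI[of _ 0]) auto
  fix y assume "(INF k\<in>{1..}. root k (f k)) < y"
  then obtain k where k: "k \<ge> 1" "root k (f k) < y"
    using cInf_less_iff[OF _ bdd] by auto
  obtain t where t: "root k (f k) < t" "t < y"
    using dense[OF k(2)] by blast
  have "t > 0"
    using root_nonneg[of k] t(1) by (rule le_less_trans)
  have "f k = root k (f k) ^ k"
    using k nonneg by (simp add: real_root_pow_pos2)
  also have "\<dots> \<le> t ^ k"
    using t root_nonneg by (intro power_mono) auto
  finally obtain D where D: "D > 0" "\<And>n. f n \<le> t ^ n * D"
    using submultiplicative_le_geometric[OF nonneg submult k(1) \<open>t > 0\<close>] by blast
  have "(\<lambda>n. t * root n D) \<longlonglongrightarrow> t * 1"
    using D by (intro tendsto_mult tendsto_const LIMSEQ_root_const)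
  then have ev: "\<forall>\<^sub>F n in sequentially. t * root n D < y"
    using t(2) by (intro order_tendstoD) auto
  have le: "root n (f n) \<le> t * root n D" if "n \<ge> 1" for n
  proof -
    have "root n (t ^ n) = t"
      using that \<open>t > 0\<close> by (intro real_root_pos2) auto
    then have "root n (t ^ n * D) = t * root n D"
      by (simp only: real_root_mult)
    moreover have "root n (f n) \<le> root n (t ^ n * D)"
      using D that by simp
    ultimately show ?thesis
      by simp
  qed
  show "\<forall>\<^sub>F n in sequentially. root n (f n) < y"
    using ev eventually_ge_at_top[of 1] by eventually_elim (use le in force)
next
  fix y assume "y < (INF k\<in>{1..}. root k (f k))"
  moreover have "(INF k\<in>{1..}. root k (f k)) \<le> root n (f n)" if "n \<ge> 1" for n
    using that nonneg by (intro cInf_lower bdd_belowI[of _ 0]) auto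
  ultimately show "\<forall>\<^sub>F n in sequentially. y < root n (f n)"
    unfolding eventually_sequentially by (meson less_le_trans)
qed

lemma jsr_le_root_max_word_norm:
  fixes A :: "nat \<Rightarrow> real^'n^'n"
  assumes "m > 0" and "k \<ge> 1"
  shows "jsr A m \<le> root k (max_word_norm A m k)"
proof -
  have "Max ((\<lambda>js. root k (onorm (\<lambda>x. word_prod A js *v x))) ` words m k) = root k (max_word_norm A m k)"
    for k
  proof -
    have "mono (root k)"
      by (cases k) (auto simp: mono_def)
    then show ?thesis
      unfolding max_word_norm_def using finite_words words_nonempty[OF assms(1)]
      by (simp add: mono_Max_commute image_image)
  qed
  then have "jsr A m = (INF k\<in>{1..}. root k (max_word_norm A m k))"
    unfolding jsr_def
    using submultiplicative_root_tendsto_Inf[OF max_word_norm_nonneg[OF assms(1), where A=A]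
          max_word_norm_submult[OF assms(1), where A=A]]
    by (simp add: limI)
  also have "\<dots> \<le> root k (max_word_norm A m k)"
    using assms max_word_norm_nonneg[OF assms(1)] by (intro cInf_lower bdd_belowI[of _ 0]) auto
  finally show ?thesis .
qed

lemma word_prod_norm_bound_iterate:
  fixes A :: "nat \<Rightarrow> real^'n^'n" and T :: "real^'n \<Rightarrow> real^'n"
  assumes "\<beta> \<ge> 0"
    and bound: "\<And>js y. js \<in> words m l \<Longrightarrow> norm (T (word_prod A js *v y)) \<le> \<beta> * norm (T y)"
  shows "js \<in> words m (q * l) \<Longrightarrow> norm (T (word_prod A js *v y)) \<le> \<beta> ^ q * norm (T y)"
proof (induction q arbitrary: js y)
  case 0
  then show ?case
    by (simp add: words_def word_prod_def)
next
  case (Suc q)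
  then have "js \<in> words m (q * l + l)"
    by (simp add: add.commute)
  then have w: "take (q * l) js \<in> words m (q * l)" "drop (q * l) js \<in> words m l"
    using words_append_split by blast+
  have "word_prod A js *v y = word_prod A (drop (q * l) js) *v (word_prod A (take (q * l) js) *v y)"
    using word_prod_append[of A "take (q * l) js" "drop (q * l) js"] by (simp add: matrix_vector_mul_assoc)
  then have "norm (T (word_prod A js *v y)) \<le> \<beta> * norm (T (word_prod A (take (q * l) js) *v y))"
    using bound[OF w(2)] by simp
  also have "\<dots> \<le> \<beta> * (\<beta> ^ q * norm (T y))"
    using Suc.IH[OF w(1)] assms(1) by (intro mult_left_mono)
  finally show ?case
    by simp
qed

lemma max_word_norm_le_geometric:
  fixes A :: "nat \<Rightarrow> real^'n^'n" and T :: "real^'n \<Rightarrow> real^'n"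
  assumes "m > 0" and "\<beta> \<ge> 0" and "linear T" and "inj T"
    and bound: "\<And>js y. js \<in> words m l \<Longrightarrow> norm (T (word_prod A js *v y)) \<le> \<beta> * norm (T y)"
  obtains K where "K > 0" "\<And>q. max_word_norm A m (q * l) \<le> K * \<beta> ^ q"
proof -
  obtain Ti where "linear Ti" and Ti: "Ti \<circ> T = id"
    using linear_injective_left_inverse[OF assms(3,4)] by blast
  have bl: "bounded_linear T" "bounded_linear Ti"
    using \<open>linear T\<close> \<open>linear Ti\<close> by (simp_all add: linear_conv_bounded_linear)
  define K where "K = onorm Ti * onorm T + 1"
  have "K > 0"
    unfolding K_def using onorm_pos_le[OF bl(1)] onorm_pos_le[OF bl(2)] by (simp add: add_nonneg_pos)
  moreover have "max_word_norm A m (q * l) \<le> K * \<beta> ^ q" for q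
  proof (intro max_word_norm_le[OF assms(1)] onorm_le)
    fix js y assume js: "js \<in> words m (q * l)"
    have "norm (word_prod A js *v y) = norm (Ti (T (word_prod A js *v y)))"
      using Ti by (simp add: pointfree_idE)
    also have "\<dots> \<le> onorm Ti * norm (T (word_prod A js *v y))"
      by (rule onorm[OF bl(2)])
    also have "\<dots> \<le> onorm Ti * (\<beta> ^ q * norm (T y))"
      using word_prod_norm_bound_iterate[OF assms(2) bound js] onorm_pos_le[OF bl(2)]
      by (rule mult_left_mono)
    also have "\<dots> \<le> onorm Ti * (\<beta> ^ q * (onorm T * norm y))"
      using onorm[OF bl(1), of y] onorm_pos_le[OF bl(2)] assms(2)
      by (intro mult_left_mono) simp_all
    also have "\<dots> \<le> K * \<beta> ^ q * norm y"
      unfolding K_def using assms(2) by (simp add: algebra_simps)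
    finally show "norm (word_prod A js *v y) \<le> K * \<beta> ^ q * norm y" .
  qed
  ultimately show thesis
    using that by blast
qed

lemma jsr_le_of_norm_bound:
  fixes A :: "nat \<Rightarrow> real^'n^'n" and T :: "real^'n \<Rightarrow> real^'n"
  assumes "m > 0" and "l > 0" and "\<beta> \<ge> 0" and "linear T" and "inj T"
    and bound: "\<And>js y. js \<in> words m l \<Longrightarrow> norm (T (word_prod A js *v y)) \<le> \<beta> * norm (T y)"
  shows "jsr A m \<le> root l \<beta>"
proof -
  obtain K where "K > 0" and K: "\<And>q. max_word_norm A m (q * l) \<le> K * \<beta> ^ q"
    using max_word_norm_le_geometric[OF assms(1,3,4,5) bound] by blast
  have le: "jsr A m \<le> root (q * l) K * root l \<beta>" if "q \<ge> 1" for q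
  proof -
    have "jsr A m \<le> root (q * l) (max_word_norm A m (q * l))"
      using that assms(2) by (intro jsr_le_root_max_word_norm assms(1)) simp
    also have "\<dots> \<le> root (q * l) (K * \<beta> ^ q)"
      using K that assms(2) by simp
    also have "\<dots> = root (q * l) K * root l (root q (\<beta> ^ q))"
      by (simp add: real_root_mult real_root_mult_exp mult.commute)
    also have "root q (\<beta> ^ q) = \<beta>"
      using that assms(3) by (intro real_root_pos2) auto
    finally show ?thesis .
  qed
  have "(\<lambda>q. root (q * l) K * root l \<beta>) \<longlonglongrightarrow> 1 * root l \<beta>"
    using LIMSEQ_subseq_LIMSEQ[OF LIMSEQ_root_const[OF \<open>K > 0\<close>], of "\<lambda>q. q * l"] assms(2)
    by (intro tendsto_mult tendsto_const) (simp_all add: strict_mono_def comp_def)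
  then have "jsr A m \<le> 1 * root l \<beta>"
    by (rule LIMSEQ_le_const) (use le in blast)
  then show ?thesis
    by simp
qed

section \<open>Spherical measure of caps\<close>

definition scone :: "(real^'n) set \<Rightarrow> (real^'n) set" where
  "scone X = {t *\<^sub>R x | x t. x \<in> X \<and> t \<in> {0..1}}"

lemma sph_measure_scone:
  fixes X :: "(real^'n) set"
  shows "sph_measure X = measure lebesgue (scone X) / measure lebesgue (cball (0::real^'n) 1)"
  unfolding sph_measure_def scone_def by (rule refl)

lemma scone_Un: "scone (X \<union> Y) = scone X \<union> scone Y"
  unfolding scone_def by blast

lemma scone_linear_image:
  assumes "linear f"
  shows "scone (f ` X) = f ` scone X"
proof (intro equalityI subsetI)
  fix y assume "y \<in> scone (f ` X)"
  then obtain x t where "x \<in> X" "t \<in> {0..1}" "y = t *\<^sub>R f x"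
    unfolding scone_def by blast
  moreover have "t *\<^sub>R x \<in> scone X"
    unfolding scone_def using \<open>x \<in> X\<close> \<open>t \<in> {0..1}\<close> by blast
  ultimately show "y \<in> f ` scone X"
    using linear_scale[OF assms, of t x] by (intro rev_image_eqI[of "t *\<^sub>R x"]) simp_all
next
  fix y assume "y \<in> f ` scone X"
  then obtain x t where "x \<in> X" "t \<in> {0..1}" "y = f (t *\<^sub>R x)"
    unfolding scone_def by blast
  then show "y \<in> scone (f ` X)"
    unfolding scone_def using linear_scale[OF assms, of t x] by blast
qed

lemma scone_Int_subset:
  assumes "X \<subseteq> sphere 0 1" "Y \<subseteq> sphere 0 1" "X \<inter> Y = {}"
  shows "scone X \<inter> scone Y \<subseteq> {0}"
proof
  fix y assume "y \<in> scone X \<inter> scone Y"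
  then obtain x t x' t' where x: "x \<in> X" "t \<in> {0..1}" "y = t *\<^sub>R x"
    and x': "x' \<in> Y" "t' \<in> {0..1}" "y = t' *\<^sub>R x'"
    unfolding scone_def by blast
  have "norm x = 1" "norm x' = 1"
    using assms(1,2) x(1) x'(1) by auto
  have "norm y = t"
    using x(2,3) \<open>norm x = 1\<close> by simp
  moreover have "norm y = t'"
    using x'(2,3) \<open>norm x' = 1\<close> by simp
  ultimately have "t = 0 \<or> x = x'"
    using x(3) x'(3) by auto
  then show "y \<in> {0}"
    using assms(3) x x' by auto
qed

lemma scone_diff_zero:
  assumes "X \<subseteq> sphere 0 1"
  shows "scone X - {0} = cball 0 1 \<inter> sgn -` X - {0}"
proof
  show "scone X - {0} \<subseteq> cball 0 1 \<inter> sgn -` X - {0}"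
  proof
    fix y assume y: "y \<in> scone X - {0}"
    then obtain x t where x: "x \<in> X" "t \<in> {0..1}" "y = t *\<^sub>R x"
      unfolding scone_def by blast
    have "norm x = 1"
      using assms x(1) by auto
    moreover have "t \<noteq> 0"
      using x(3) y by auto
    ultimately have "sgn y = x" "norm y \<le> 1"
      using x(2,3) by (simp_all add: sgn_div_norm)
    with x(1) y show "y \<in> cball 0 1 \<inter> sgn -` X - {0}"
      by simp
  qed
  show "cball 0 1 \<inter> sgn -` X - {0} \<subseteq> scone X - {0}"
  proof
    fix y assume y: "y \<in> cball 0 1 \<inter> sgn -` X - {0}"
    then have "y = norm y *\<^sub>R sgn y" "sgn y \<in> X" "norm y \<in> {0..1}"
      by (simp_all add: sgn_div_norm)
    with y show "y \<in> scone X - {0}"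
      unfolding scone_def by blast
  qed
qed

lemma lmeasurable_scone:
  assumes "X \<in> sets borel" and "X \<subseteq> sphere 0 1"
  shows "scone X \<in> lmeasurable"
proof -
  have "(sgn :: real^'n \<Rightarrow> real^'n) \<in> borel_measurable borel"
    unfolding sgn_div_norm by measurable
  from measurable_sets[OF this assms(1)] have "sgn -` X \<in> sets borel"
    by simp
  then have "cball 0 1 \<inter> sgn -` X - {0} \<in> sets borel"
    by (rule sets.Diff[OF sets.Int[OF borel_closed[OF closed_cball]] borel_closed[OF closed_singleton]])
  then have "cball 0 1 \<inter> sgn -` X - {0} \<in> sets lebesgue"
    by (metis sets_completionI_sets sets_lborel)
  then have "cball 0 1 \<inter> sgn -` X - {0} \<in> lmeasurable"
    using bounded_subset[OF bounded_cball] by (intro bounded_set_imp_lmeasurable) blast+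
  moreover have "sym_diff (cball 0 1 \<inter> sgn -` X - {0}) (scone X) \<subseteq> {0}"
    using scone_diff_zero[OF assms(2)] by blast
  then have "negligible (sym_diff (cball 0 1 \<inter> sgn -` X - {0}) (scone X))"
    using negligible_subset negligible_sing by blast
  ultimately show ?thesis
    by (rule lmeasurable_negligible_symdiff)
qed

lemma sph_measure_Un:
  assumes "X \<in> sets borel" "X \<subseteq> sphere 0 1" "Y \<in> sets borel" "Y \<subseteq> sphere 0 1" "X \<inter> Y = {}"
  shows "sph_measure (X \<union> Y) = sph_measure X + sph_measure Y"
proof -
  have "negligible (scone X \<inter> scone Y)"
    using scone_Int_subset[OF assms(2,4,5)] negligible_subset negligible_sing by blast
  then have "measure lebesgue (scone X \<union> scone Y) = measure lebesgue (scone X) + measure lebesgue (scone Y)"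
    using lmeasurable_scone[OF assms(1,2)] lmeasurable_scone[OF assms(3,4)]
    by (simp add: measure_Un3 negligible_imp_measure0)
  then show ?thesis
    by (simp add: sph_measure_scone scone_Un add_divide_distrib)
qed

lemma sph_measure_uminus:
  assumes "X \<in> sets borel" "X \<subseteq> sphere 0 1"
  shows "sph_measure (uminus ` X) = sph_measure X"
proof -
  have "measure lebesgue ((*\<^sub>R) (-1) ` scone X) = measure lebesgue (scone X)"
    using measure_linear_image_cart[OF linear_scaleR lmeasurable_scone[OF assms], of "-1"]
    by (simp only: det_matrix_scaleR) (simp add: power_abs)
  moreover have "(*\<^sub>R) (-1) ` scone X = uminus ` scone X"
    by (simp add: image_def)
  ultimately show ?thesis
    by (simp add: sph_measure_scone scone_linear_image[OF linear_uminus])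
qed

lemma sph_measure_linear_image_le:
  fixes L :: "real^'n \<Rightarrow> real^'n"
  assumes "linear L" and "X \<in> sets borel" "X \<subseteq> sphere 0 1" and "Y \<in> sets borel" "Y \<subseteq> sphere 0 1"
    and "L ` scone X \<subseteq> scone Y"
  shows "\<bar>det (matrix L)\<bar> * sph_measure X \<le> sph_measure Y"
proof -
  have "L ` scone X \<in> lmeasurable"
    by (rule lmeasurable_linear_image_cart[OF assms(1) lmeasurable_scone[OF assms(2,3)]])
  have "\<bar>det (matrix L)\<bar> * measure lebesgue (scone X) = measure lebesgue (L ` scone X)"
    using measure_linear_image_cart[OF assms(1) lmeasurable_scone[OF assms(2,3)]] by simp
  also have "\<dots> \<le> measure lebesgue (scone Y)"
    using assms(6) fmeasurableD[OF \<open>L ` scone X \<in> lmeasurable\<close>] lmeasurable_scone[OF assms(4,5)]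
    by (rule measure_mono_fmeasurable)
  finally show ?thesis
    using content_cball_pos[of 1 "0::real^'n"] by (simp add: sph_measure_scone divide_right_mono)
qed

lemma Delta_nonneg: "Delta X \<ge> 0"
  unfolding Delta_def Let_def
  by (auto intro!: cSup_upper2 bdd_aboveI[of _ 1])

lemma Delta_le_if_separated:
  fixes X :: "(real^'n) set"
  assumes "norm e = 1" and "r \<ge> 0" and "\<And>z. z \<in> sphere 0 1 - X \<Longrightarrow> e \<bullet> z < r"
  shows "Delta X \<le> r"
proof -
  have "convex hull (sphere 0 1 - X) \<subseteq> {z. e \<bullet> z < r}"
    using assms(3) by (intro hull_minimal convex_halfspace_lt) auto
  have "\<rho> \<le> r" if "\<rho> \<ge> 0" "cball 0 \<rho> \<subseteq> convex hull (sphere 0 1 - X)" for \<rho>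
  proof -
    have "\<rho> *\<^sub>R e \<in> cball 0 \<rho>"
      using that(1) assms(1) by simp
    then have "e \<bullet> (\<rho> *\<^sub>R e) < r"
      using that(2) \<open>convex hull (sphere 0 1 - X) \<subseteq> {z. e \<bullet> z < r}\<close> by blast
    then show ?thesis
      using assms(1) by (simp add: dot_square_norm)
  qed
  then show ?thesis
    unfolding Delta_def Let_def using assms(2) by (auto intro!: cSup_least)
qed

lemma delta_fun_le_Delta:
  fixes X :: "(real^'n) set"
  assumes "X \<in> sets borel" "X \<subseteq> sphere 0 1" "sph_measure X \<le> e"
  shows "delta_fun e TYPE('n) \<le> Delta X"
  unfolding delta_fun_def using assms Delta_nonneg
  by (intro cInf_lower bdd_belowI[of _ 0]) auto

lemma separating_unit_vector:
  fixes S :: "(real^'n) set"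
  assumes "convex S" "closed S" "w \<notin> S"
  obtains e where "norm e = 1" "\<And>x. x \<in> S \<Longrightarrow> e \<bullet> x < e \<bullet> w"
proof -
  obtain a b where ab: "a \<bullet> w < b" "\<And>x. x \<in> S \<Longrightarrow> b < a \<bullet> x"
    using separating_hyperplane_closed_point[OF assms] by blast
  show thesis
  proof (cases "a = 0")
    case True
    then have "S = {}"
      using ab by force
    obtain e :: "real^'n" where "norm e = 1"
      using vector_choose_size[of 1] by auto
    with \<open>S = {}\<close> show thesis
      using that by blast
  next
    case False
    have "(- a /\<^sub>R norm a) \<bullet> x < (- a /\<^sub>R norm a) \<bullet> w" if "x \<in> S" for x
      using ab(1) ab(2)[OF that] False by (simp add: divide_strict_right_mono)
    then show thesis
      using that[of "- a /\<^sub>R norm a"] False by simp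
  qed
qed

lemma scaled_not_in_cone_in_scone:
  fixes G St :: "(real^'n) set"
  assumes cone: "0 \<in> G" "\<And>c x. x \<in> G \<Longrightarrow> c *\<^sub>R x \<in> G"
    and good: "sphere 0 1 - St \<subseteq> G"
    and "x \<notin> G" and "norm (c *\<^sub>R x) \<le> 1"
  shows "c *\<^sub>R x \<in> scone St"
proof -
  have "x \<noteq> 0"
    using assms(4) cone(1) by auto
  have St_sgn: "\<epsilon> *\<^sub>R sgn x \<in> St" if "\<epsilon> = 1 \<or> \<epsilon> = -1" for \<epsilon>
  proof -
    have "\<epsilon> *\<^sub>R sgn x \<notin> G"
    proof
      assume "\<epsilon> *\<^sub>R sgn x \<in> G"
      then have "(\<epsilon> * norm x) *\<^sub>R (\<epsilon> *\<^sub>R sgn x) \<in> G"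
        by (rule cone(2))
      with that \<open>x \<noteq> 0\<close> \<open>x \<notin> G\<close> show False
        by (auto simp: sgn_div_norm)
    qed
    moreover have "\<epsilon> *\<^sub>R sgn x \<in> sphere 0 1"
      using that \<open>x \<noteq> 0\<close> by (auto simp: norm_sgn)
    ultimately show ?thesis
      using good by blast
  qed
  show ?thesis
  proof (cases "c \<ge> 0")
    case True
    then have "c *\<^sub>R x = (c * norm x) *\<^sub>R (1 *\<^sub>R sgn x)" "c * norm x \<in> {0..1}"
      using assms(5) \<open>x \<noteq> 0\<close> by (simp_all add: sgn_div_norm)
    then show ?thesis
      unfolding scone_def using St_sgn[of 1] by blast
  next
    case False
    then have "c *\<^sub>R x = (- c * norm x) *\<^sub>R ((-1) *\<^sub>R sgn x)" "- c * norm x \<in> {0..1}"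
      using assms(5) \<open>x \<noteq> 0\<close> by (simp_all add: sgn_div_norm mult_nonpos_nonneg)
    then show ?thesis
      unfolding scone_def using St_sgn[of "-1"] by blast
  qed
qed

lemma compact_sphere_cap: "compact {z \<in> sphere (0::'a::euclidean_space) 1. r \<le> e \<bullet> z}"
proof -
  have "{z \<in> sphere (0::'a) 1. r \<le> e \<bullet> z} = sphere 0 1 \<inter> {z. r \<le> e \<bullet> z}"
    by blast
  then show ?thesis
    by (simp add: compact_Int_closed closed_halfspace_ge)
qed

lemma sph_measure_cap_le:
  fixes L :: "real^'n \<Rightarrow> real^'n" and G St :: "(real^'n) set"
  assumes L: "linear L" "\<And>z. norm (L z) \<le> norm z"
    and cone: "0 \<in> G" "\<And>c x. x \<in> G \<Longrightarrow> c *\<^sub>R x \<in> G"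
    and St: "St \<in> sets borel" "St \<subseteq> sphere 0 1" "sph_measure St \<le> \<epsilon>" "sphere 0 1 - St \<subseteq> G"
    and "r > 0" and bad: "\<And>c. c \<in> sphere 0 1 \<Longrightarrow> r \<le> e \<bullet> c \<Longrightarrow> L c \<notin> G"
  shows "\<bar>det (matrix L)\<bar> * (2 * sph_measure {z \<in> sphere 0 1. r \<le> e \<bullet> z}) \<le> \<epsilon>"
proof -
  define Cap where "Cap = {z \<in> sphere 0 1. r \<le> e \<bullet> z}"
  have "compact Cap"
    unfolding Cap_def by (rule compact_sphere_cap)
  then have Cap_borel: "Cap \<in> sets borel" "uminus ` Cap \<in> sets borel"
    by (simp_all add: borel_compact compact_negations)
  have Cap_sphere: "Cap \<subseteq> sphere 0 1" "uminus ` Cap \<subseteq> sphere 0 1"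
    by (auto simp: Cap_def)
  have "Cap \<inter> uminus ` Cap = {}"
    using \<open>r > 0\<close> by (auto simp: Cap_def)
  then have "sph_measure (Cap \<union> uminus ` Cap) = 2 * sph_measure Cap"
    using sph_measure_Un[OF Cap_borel(1) Cap_sphere(1) Cap_borel(2) Cap_sphere(2)]
      sph_measure_uminus[OF Cap_borel(1) Cap_sphere(1)] by simp
  moreover have "L ` scone (Cap \<union> uminus ` Cap) \<subseteq> scone St"
  proof
    fix y assume "y \<in> L ` scone (Cap \<union> uminus ` Cap)"
    then obtain c t where c: "c \<in> Cap \<union> uminus ` Cap" and t: "t \<in> {0..1}" and y: "y = t *\<^sub>R L c"
      unfolding scone_def using linear_scale[OF L(1)] by auto
    have "L c \<notin> G"
    proof
      assume "L c \<in> G"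
      then have "L c \<in> G" "L (- c) \<in> G"
        using cone(2)[of "L c" "-1"] linear_neg[OF L(1)] by simp_all
      with c bad show False
        unfolding Cap_def by force
    qed
    moreover have "norm c = 1"
      using c Cap_sphere by auto
    then have "norm (t *\<^sub>R L c) \<le> 1"
      using t L(2)[of c] by (simp add: mult_le_one)
    ultimately show "y \<in> scone St"
      using scaled_not_in_cone_in_scone[OF cone St(4)] y by blast
  qed
  then have "\<bar>det (matrix L)\<bar> * sph_measure (Cap \<union> uminus ` Cap) \<le> sph_measure St"
    using Cap_borel Cap_sphere St(1,2)
    by (intro sph_measure_linear_image_le[OF L(1)]) auto
  ultimately show ?thesis
    using St(3) unfolding Cap_def by simp
qed

lemma ball_subset_closure_hull_good_directions:
  fixes L :: "real^'n \<Rightarrow> real^'n" and G St :: "(real^'n) set"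
  assumes L: "linear L" "\<And>z. norm (L z) \<le> norm z" "det (matrix L) \<noteq> 0"
    and cone: "0 \<in> G" "\<And>c x. x \<in> G \<Longrightarrow> c *\<^sub>R x \<in> G"
    and St: "St \<in> sets borel" "St \<subseteq> sphere 0 1" "sph_measure St \<le> \<epsilon>" "sphere 0 1 - St \<subseteq> G"
  shows "ball 0 (delta_fun (\<epsilon> / \<bar>det (matrix L)\<bar> / 2) TYPE('n))
           \<subseteq> closure (convex hull {z \<in> sphere 0 1. L z \<in> G})"
proof
  define \<delta> where "\<delta> = delta_fun (\<epsilon> / \<bar>det (matrix L)\<bar> / 2) TYPE('n)"
  define K where "K = closure (convex hull {z \<in> sphere 0 1. L z \<in> G})"
  fix w :: "real^'n"
  assume "w \<in> ball 0 (delta_fun (\<epsilon> / \<bar>det (matrix L)\<bar> / 2) TYPE('n))"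
  then have w: "norm w < \<delta>"
    by (simp add: \<delta>_def)
  show "w \<in> closure (convex hull {z \<in> sphere 0 1. L z \<in> G})"
  proof (rule ccontr)
    assume "w \<notin> closure (convex hull {z \<in> sphere 0 1. L z \<in> G})"
    then obtain e where e: "norm e = 1" "\<And>x. x \<in> K \<Longrightarrow> e \<bullet> x < e \<bullet> w"
      using separating_unit_vector[OF convex_closure[OF convex_convex_hull] closed_closure]
      unfolding K_def by blast
    obtain r where r: "norm w < r" "r < \<delta>"
      using dense[OF w] by blast
    have "0 < r"
      using le_less_trans[OF norm_ge_zero r(1)] .
    have "e \<bullet> w < r"
      using norm_cauchy_schwarz[of e w] e(1) r(1) by simp
    have sep: "e \<bullet> z < r" if "z \<in> sphere 0 1" "L z \<in> G" for z
    proof -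
      have "z \<in> K"
        unfolding K_def using that by (intro subsetD[OF closure_subset] hull_inc) simp
      then show ?thesis
        using e(2) \<open>e \<bullet> w < r\<close> by (meson less_trans)
    qed
    let ?Cap = "{z \<in> sphere 0 1. r \<le> e \<bullet> z}"
    have "\<bar>det (matrix L)\<bar> * (2 * sph_measure ?Cap) \<le> \<epsilon>"
      using sph_measure_cap_le[OF L(1,2) cone St \<open>0 < r\<close>] sep not_less by blast
    then have "sph_measure ?Cap * (\<bar>det (matrix L)\<bar> * 2) \<le> \<epsilon>"
      by (simp only: ac_simps)
    then have cap_measure: "sph_measure ?Cap \<le> \<epsilon> / \<bar>det (matrix L)\<bar> / 2"
      using L(3) by (simp add: pos_le_divide_eq)
    have "\<delta> \<le> Delta ?Cap"
      unfolding \<delta>_def by (rule delta_fun_le_Delta[OF borel_compact[OF compact_sphere_cap] _ cap_measure]) auto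
    also have "Delta ?Cap \<le> r"
      using \<open>0 < r\<close> by (intro Delta_le_if_separated[OF e(1)]) auto
    finally show False
      using r(2) by simp
  qed
qed

corollary cball_subset_closure_hull_good_directions:
  fixes L :: "real^'n \<Rightarrow> real^'n" and G St :: "(real^'n) set"
  assumes "linear L" "\<And>z. norm (L z) \<le> norm z" "det (matrix L) \<noteq> 0"
    and "0 \<in> G" "\<And>c x. x \<in> G \<Longrightarrow> c *\<^sub>R x \<in> G"
    and "St \<in> sets borel" "St \<subseteq> sphere 0 1" "sph_measure St \<le> \<epsilon>" "sphere 0 1 - St \<subseteq> G"
    and "delta_fun (\<epsilon> / \<bar>det (matrix L)\<bar> / 2) TYPE('n) > 0"
  shows "cball 0 (delta_fun (\<epsilon> / \<bar>det (matrix L)\<bar> / 2) TYPE('n))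
           \<subseteq> closure (convex hull {z \<in> sphere 0 1. L z \<in> G})"
proof -
  have "closure (ball 0 (delta_fun (\<epsilon> / \<bar>det (matrix L)\<bar> / 2) TYPE('n)))
          \<subseteq> closure (convex hull {z \<in> sphere 0 1. L z \<in> G})"
    using ball_subset_closure_hull_good_directions[OF assms(1-9)] closed_closure by (rule closure_minimal)
  with assms(10) show ?thesis
    by simp
qed

section \<open>Norm bound from the good directions\<close>

lemma norm_le_if_cball_subset_closure_hull:
  fixes M :: "'a::euclidean_space \<Rightarrow> 'b::real_normed_vector"
  assumes "linear M" "\<delta> > 0" "cball 0 \<delta> \<subseteq> closure (convex hull Z)"
    and bound: "\<And>z. z \<in> Z \<Longrightarrow> norm (M z) \<le> c"
  shows "\<delta> * norm (M z) \<le> c * norm z"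
proof (cases "z = 0")
  case False
  have "closed (M -` cball 0 c)" "convex (M -` cball 0 c)"
    using assms(1) by (simp_all add: closed_vimage linear_continuous_on linear_conv_bounded_linear
        convex_linear_vimage)
  then have "closure (convex hull Z) \<subseteq> M -` cball 0 c"
    using bound by (intro closure_minimal hull_minimal) auto
  moreover have "(\<delta> / norm z) *\<^sub>R z \<in> cball 0 \<delta>"
    using False \<open>\<delta> > 0\<close> by simp
  ultimately have "(\<delta> / norm z) *\<^sub>R z \<in> M -` cball 0 c"
    using assms(3) by blast
  then have "norm (M ((\<delta> / norm z) *\<^sub>R z)) \<le> c"
    by simp
  then show ?thesis
    using False \<open>\<delta> > 0\<close> by (simp add: linear_scale[OF assms(1)] field_simps)
qed (simp add: linear_0[OF assms(1)])

lemma word_prod_norm_bound_of_good_sphere: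
  fixes A :: "nat \<Rightarrow> real^'n^'n" and T L :: "real^'n \<Rightarrow> real^'n"
  assumes T: "linear T" "linear L" "s > 0" "\<And>x. L (T x) = s *\<^sub>R x" "\<And>z. T (L z) = s *\<^sub>R z"
      "\<And>z. norm (L z) \<le> norm z" "det (matrix L) \<noteq> 0"
    and St: "St \<in> sets borel" "St \<subseteq> sphere 0 1" "sph_measure St \<le> \<epsilon>"
    and good: "\<And>x js. x \<in> sphere 0 1 - St \<Longrightarrow> js \<in> words m l \<Longrightarrow>
                 norm (T (word_prod A js *v x)) \<le> c * norm (T x)"
    and \<delta>: "delta_fun (\<epsilon> / \<bar>det (matrix L)\<bar> / 2) TYPE('n) > 0"
    and "js \<in> words m l"
  shows "delta_fun (\<epsilon> / \<bar>det (matrix L)\<bar> / 2) TYPE('n) * norm (T (word_prod A js *v y))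
           \<le> c * norm (T y)"
proof -
  define \<delta> where "\<delta> = delta_fun (\<epsilon> / \<bar>det (matrix L)\<bar> / 2) TYPE('n)"
  define G where "G = {x. \<forall>js\<in>words m l. norm (T (word_prod A js *v x)) \<le> c * norm (T x)}"
  have "0 \<in> G"
    by (simp add: G_def linear_0[OF T(1)])
  moreover have "a *\<^sub>R x \<in> G" if "x \<in> G" for a x
  proof -
    have "\<bar>a\<bar> * norm (T (word_prod A js *v x)) \<le> \<bar>a\<bar> * (c * norm (T x))" if "js \<in> words m l" for js
      using \<open>x \<in> G\<close> that by (intro mult_left_mono) (auto simp: G_def)
    then show ?thesis
      by (simp add: G_def matrix_vector_mult_scaleR linear_scale[OF T(1)] mult.left_commute)
  qed
  moreover have "sphere 0 1 - St \<subseteq> G"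
    using good by (auto simp: G_def)
  ultimately have cball: "cball 0 \<delta> \<subseteq> closure (convex hull {z \<in> sphere 0 1. L z \<in> G})"
    unfolding \<delta>_def by (rule cball_subset_closure_hull_good_directions[OF T(2,6,7) _ _ St _ \<delta>])
  have "linear (\<lambda>z. T (word_prod A js *v L z))"
    using linear_compose[OF linear_compose[OF T(2) matrix_vector_mul_linear] T(1)] by (simp add: o_def)
  then have "\<delta> * norm (T (word_prod A js *v L z)) \<le> (c * s) * norm z" for z
  proof (rule norm_le_if_cball_subset_closure_hull[OF _ _ cball])
    fix z assume "z \<in> {z \<in> sphere 0 1. L z \<in> G}"
    then show "norm (T (word_prod A js *v L z)) \<le> c * s"
      using \<open>js \<in> words m l\<close> T(3,5) by (auto simp: G_def)
  qed (use \<delta> in \<open>simp add: \<delta>_def\<close>)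
  moreover have "norm (T (word_prod A js *v L (T y))) = s * norm (T (word_prod A js *v y))"
    using T(3) by (simp add: T(4) matrix_vector_mult_scaleR linear_scale[OF T(1)])
  ultimately have "s * (\<delta> * norm (T (word_prod A js *v y))) \<le> s * (c * norm (T y))"
    by (metis mult.assoc mult.commute)
  then show ?thesis
    unfolding \<delta>_def using T(3) by (rule mult_left_le_imp_le)
qed

lemma norm_le_of_quadf_le:
  fixes T :: "real^'n \<Rightarrow> real^'n"
  assumes "\<And>x. (norm (T x))\<^sup>2 = quadf P x" and "\<gamma> \<ge> 0"
    and "quadf P u \<le> \<gamma> ^ (2 * l) * quadf P v"
  shows "norm (T u) \<le> \<gamma> ^ l * norm (T v)"
proof (rule power2_le_imp_le)
  show "(norm (T u))\<^sup>2 \<le> (\<gamma> ^ l * norm (T v))\<^sup>2"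
    using assms(3) by (simp add: assms(1) power_mult_distrib power_even_eq)
qed (use assms(2) in simp)

theorem theorem5:
  fixes A :: "nat \<Rightarrow> real^'n^'n" and m l :: nat and \<gamma> \<eta> \<epsilon> :: real
    and \<omega> :: "((real^'n) \<times> nat list) set" and P :: "real^'n^'n" and St :: "(real^'n) set"
  assumes "m > 0" and "l > 0" and "\<gamma> > 0"
    and "finite \<omega>" and "\<omega> \<subseteq> sphere 0 1 \<times> words m l" and "\<eta> > 0"
    and "opt_solution A l \<eta> \<omega> P" and "posdef P"
    and "St \<in> sets borel" and "St \<subseteq> sphere 0 1" and "sph_measure St \<le> \<epsilon>"
    and "\<forall>x \<in> sphere 0 1 - St. \<forall>js \<in> words m l.
           quadf P (word_prod A js *v x) \<le> \<gamma> ^ (2*l) * quadf P x"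
  shows "delta_fun (\<epsilon> * kappa P / 2) TYPE('n) > 0 \<longrightarrow>
         jsr A m \<le> \<gamma> / root l (delta_fun (\<epsilon> * kappa P / 2) TYPE('n))"
proof
  define \<delta> where "\<delta> = delta_fun (\<epsilon> * kappa P / 2) TYPE('n)"
  assume "delta_fun (\<epsilon> * kappa P / 2) TYPE('n) > 0"
  then have "\<delta> > 0"
    by (simp add: \<delta>_def)
  obtain T L s where T: "linear T" "inj T" "linear L" "s > 0" "\<And>x. (norm (T x))\<^sup>2 = quadf P x"
      "\<And>x. L (T x) = s *\<^sub>R x" "\<And>z. T (L z) = s *\<^sub>R z" "\<And>z. norm (L z) \<le> norm z"
      "det (matrix L) \<noteq> 0" and kappa: "kappa P = 1 / \<bar>det (matrix L)\<bar>"
    using posdef_normalizing_maps[OF assms(8)] by blast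
  have good: "norm (T (word_prod A js *v x)) \<le> \<gamma> ^ l * norm (T x)"
    if "x \<in> sphere 0 1 - St" "js \<in> words m l" for x js
    using assms(3,12) that by (intro norm_le_of_quadf_le[OF T(5)]) auto
  have "\<delta> * norm (T (word_prod A js *v y)) \<le> \<gamma> ^ l * norm (T y)" if "js \<in> words m l" for js y
    using word_prod_norm_bound_of_good_sphere[OF T(1,3,4,6-9) assms(9-11) good _ that] \<open>\<delta> > 0\<close>
    by (simp add: \<delta>_def kappa)
  then have "norm (T (word_prod A js *v y)) \<le> \<gamma> ^ l / \<delta> * norm (T y)" if "js \<in> words m l" for js y
    using that \<open>\<delta> > 0\<close> by (simp add: field_simps)
  then have "jsr A m \<le> root l (\<gamma> ^ l / \<delta>)"
    using assms(3) \<open>\<delta> > 0\<close> by (intro jsr_le_of_norm_bound[OF assms(1,2) _ T(1,2)]) auto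
  also have "root l (\<gamma> ^ l / \<delta>) = \<gamma> / root l \<delta>"
    using assms(2,3) by (simp add: real_root_divide real_root_pos2)
  finally show "jsr A m \<le> \<gamma> / root l (delta_fun (\<epsilon> * kappa P / 2) TYPE('n))"
    by (simp add: \<delta>_def)
qed

end
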